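(* Let $B_0$ be a skew-symmetrizable integer $n\times n$ matrix, taken as initial exchange matrix, and suppose that $u_0>0$ (that is, $u_0\in\mathbb R^n$ is non-zero with all entries non-negative) is a radical vector for $B_0$, i.e. $B_0u_0=0$. Assume the sign coherence property: for every matrix $B_1$ mutation-equivalent to $B_0$, in every $Y$-seed $(\mathbf c,B)$ with respect to the initial $Y$-seed $(\mathbf c_0,B_1)$, each vector $\mathbf c_j$ has either all entries non-negative or all entries non-positive. Suppose also that, for any $Y$-seed $(\mathbf c,B)$ with respect to the initial $Y$-seed $(\mathbf c_0,B_0)$, the coordinates of $u_0$ with respect to the basis $\mathbf c$ are non-negative. Then, for any $B$ which is mutation-equivalent to $B_0$, the matrix $B$ does not have any maximal green sequences.
   Context: An integer $n\times n$ matrix $B$ is skew-symmetrizable if there is a diagonal matrix $D$ with positive diagonal entries such that $DB$ is skew-symmetric. Notation: $[b]_+=\max(b,0)$. For $k\in\{1,\dots,n\}$, the matrix mutation $\mu_k(B)=B'$ is given by $B'_{ij}=-B_{ij}$ if $i=k$ or $j=k$, and $B'_{ij}=B_{ij}+[B_{ik}]_+[B_{kj}]_+-[-B_{ik}]_+[-B_{kj}]_+$ otherwise. It is an involution; two skew-symmetrizable matrices are mutation-equivalent if one is obtained from the other by a finite sequence of mutations. A $Y$-seed is a pair $(\mathbf c,B)$ with $B$ a skew-symmetrizable integer $n\times n$ matrix and $\mathbf c=(\mathbf c_1,\dots,\mathbf c_n)$ a tuple of non-zero vectors in $\mathbb Z^n$. Write $\mathbf c_j>0$ (resp. $\mathbf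 c_j<0$) if all entries of the non-zero vector $\mathbf c_j$ are non-negative (resp. non-positive), and $\operatorname{sgn}(\mathbf c_j)=1$ (resp. $-1$) accordingly. If $\mathbf c_k>0$ or $\mathbf c_k<0$, the $Y$-seed mutation $\mu_k(\mathbf c,B)=(\mathbf c',B')$ is defined by $B'=\mu_k(B)$, $\mathbf c'_k=-\mathbf c_k$, and $\mathbf c'_i=\mathbf c_i+[\operatorname{sgn}(\mathbf c_k)B_{k,i}]_+\mathbf c_k$ for $i\ne k$. The tuple $\mathbf c_0$ is always the tuple of standard basis vectors of $\mathbb Z^n$. For a skew-symmetrizable matrix $B_1$, a $Y$-seed with respect to the initial $Y$-seed $(\mathbf c_0,B_1)$ is one obtained from $(\mathbf c_0,B_1)$ by a finite (possibly empty) sequence of $Y$-seed mutations. Under the sign coherence property, all mutations are defined, and in each such $Y$-seed $\mathbf c$ is a basis of $\mathbb Z^n$; the coordinates of a vector $v$ with respect to $\mathbf c$ are the numbers $a_i$ with $v=\sum_i a_i\mathbf c_i$. A green sequence for a skew-symmetrizable matrix $B_1$ is a sequence $(i_1,\dots,i_l)$ of indices such that for every $1\le k\le l$, writing $(\mathbf c,B)=\mu_{i_{k-1}}\circ\cdots\circ\mu_{i_1}(\mathbf c_0,B_1)$ (with $(\mathbf c,B)=(\mathbf c_0,B_1)$ if $k=1$), one has $\mathbf c_{i_k}>0$. It is maximal if for $(\mathbf c,B)=\mu_{i_l}\circ\cdots\circ\mu_{i_1}(\mathbf c_0,B_1)$ one has $\mathbf c_k<0$ for all $k=1,\dots,n$.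 *)

theory Defs
  imports "HOL-Analysis.Analysis"
begin

text \<open>
  For vectors the library order is componentwise, with \<open>v < w\<close> meaning \<open>v \<le> w \<and> \<not> w \<le> v\<close>.
  So \<open>0 < v\<close> says that \<open>v\<close> is non-zero with all entries non-negative, and \<open>v < 0\<close> that it is
  non-zero with all entries non-positive.
\<close>

definition skew_symmetrizable :: "int^'n^'n \<Rightarrow> bool" where
  "skew_symmetrizable B \<longleftrightarrow>
    (\<exists>D :: real^'n^'n. (\<forall>i j. i \<noteq> j \<longrightarrow> D $ i $ j = 0) \<and> (\<forall>i. 0 < D $ i $ i) \<and>
       transpose (D ** map_matrix real_of_int B) = - (D ** map_matrix real_of_int B))"

definition matrix_mutation :: "'n \<Rightarrow> int^'n^'n \<Rightarrow> int^'n^'n" where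
  "matrix_mutation k B =
    (\<chi> i j. if i = k \<or> j = k then - (B $ i $ j)
            else B $ i $ j + max (B $ i $ k) 0 * max (B $ k $ j) 0
                 - max (- (B $ i $ k)) 0 * max (- (B $ k $ j)) 0)"

text \<open>
  Matrix mutations are involutions that preserve skew-symmetrizability, so for a
  skew-symmetrizable starting matrix this reachability relation is symmetric and stays among
  skew-symmetrizable matrices.
\<close>

definition mutation_equivalent :: "int^'n^'n \<Rightarrow> int^'n^'n \<Rightarrow> bool" where
  "mutation_equivalent = (\<lambda>B B'. \<exists>k. B' = matrix_mutation k B)\<^sup>*\<^sup>*"

type_synonym 'n y_seed = "('n \<Rightarrow> int^'n) \<times> (int^'n^'n)"

definition sgn_vec :: "int^'n \<Rightarrow> int" where
  "sgn_vec v = (if 0 < v then 1 else if v < 0 then - 1 else 0)"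

text \<open>
  This is the intended mutation only where \<open>0 < c k\<close> or \<open>c k < 0\<close>; wherever it is used below,
  that condition is required.
\<close>

fun y_seed_mutation :: "'n::finite \<Rightarrow> 'n y_seed \<Rightarrow> 'n y_seed" where
  "y_seed_mutation k (c, B) =
    ((\<lambda>i. if i = k then - c k else c i + max (sgn_vec (c k) * B $ k $ i) 0 *s c k),
     matrix_mutation k B)"

definition initial_y_seed :: "int^'n^'n \<Rightarrow> 'n y_seed" where
  "initial_y_seed B = ((\<lambda>i. axis i 1), B)"

inductive y_seed_wrt :: "int^'n^'n \<Rightarrow> 'n y_seed \<Rightarrow> bool" for B1 where
  initial: "y_seed_wrt B1 (initial_y_seed B1)"
| mutate: "y_seed_wrt B1 (c, B) \<Longrightarrow> 0 < c k \<or> c k < 0 \<Longrightarrow>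
             y_seed_wrt B1 (y_seed_mutation k (c, B))"

definition sign_coherent :: "int^'n^'n \<Rightarrow> bool" where
  "sign_coherent B1 \<longleftrightarrow> (\<forall>c B. y_seed_wrt B1 (c, B) \<longrightarrow> (\<forall>j. 0 \<le> c j \<or> c j \<le> 0))"

definition is_coordinates :: "('n \<Rightarrow> int^'n) \<Rightarrow> real^'n \<Rightarrow> ('n \<Rightarrow> real) \<Rightarrow> bool" where
  "is_coordinates c v a \<longleftrightarrow> v = (\<Sum>i\<in>UNIV. a i *\<^sub>R (\<chi> j. real_of_int (c i $ j)))"

text \<open>
  The head of the list is mutated first.  In a green sequence every mutation performed is at an
  index \<open>k\<close> with \<open>0 < c k\<close>, hence is a genuine one.
\<close>

definition green_sequence :: "int^'n^'n \<Rightarrow> 'n list \<Rightarrow> bool" where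
  "green_sequence B1 ks \<longleftrightarrow>
    (\<forall>m < length ks. 0 < fst (fold y_seed_mutation (take m ks) (initial_y_seed B1)) (ks ! m))"

definition maximal_green_sequence :: "int^'n^'n \<Rightarrow> 'n list \<Rightarrow> bool" where
  "maximal_green_sequence B1 ks \<longleftrightarrow>
    green_sequence B1 ks \<and> (\<forall>k. fst (fold y_seed_mutation ks (initial_y_seed B1)) k < 0)"

end

theory Submission imports Defs begin

text \<open>
  The coordinates \<open>a\<close> of a radical vector with respect to the \<open>c\<close>-vectors of a \<open>Y\<close>-seed
  \<open>(c, B)\<close> satisfy \<open>B a = 0\<close>. Hence \<open>\<Sum>\<^sub>j [B\<^sub>k\<^sub>j]\<^sub>+ a\<^sub>j = \<Sum>\<^sub>j [- B\<^sub>k\<^sub>j]\<^sub>+ a\<^sub>j\<close>, so the rule by which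
  they change under mutation does not involve the sign of \<open>c\<^sub>k\<close> and depends on \<open>(a, B)\<close> only.
  Transport \<open>u\<^sub>0\<close> along a mutation path from \<open>B\<^sub>0\<close> to \<open>B\<close> to a radical vector \<open>u > 0\<close> of \<open>B\<close>. The
  coordinates of \<open>u\<close> in any \<open>Y\<close>-seed with initial matrix \<open>B\<close> are then also coordinates of \<open>u\<^sub>0\<close> in
  some \<open>Y\<close>-seed with initial matrix \<open>B\<^sub>0\<close>, hence non-negative. At the end of a maximal green
  sequence all \<open>c\<close>-vectors are negative, which would force \<open>u \<le> 0\<close>.
\<close>

section \<open>Skew-symmetrizable matrices and their mutations\<close>

lemma skew_symmetrizable_iff:
  fixes B :: "int^'n^'n"
  shows "skew_symmetrizable B \<longleftrightarrow>
    (\<exists>d. (\<forall>i. 0 < d i) \<and> (\<forall>i j. d i * real_of_int (B $ i $ j) = - (d j * real_of_int (B $ j $ i))))"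
    (is "_ \<longleftrightarrow> (\<exists>d. ?P d)")
proof
  assume "skew_symmetrizable B"
  then obtain D :: "real^'n^'n" where diag: "\<And>i j. i \<noteq> j \<Longrightarrow> D $ i $ j = 0"
    and pos: "\<And>i. 0 < D $ i $ i"
    and skew: "transpose (D ** map_matrix real_of_int B) = - (D ** map_matrix real_of_int B)"
    unfolding skew_symmetrizable_def by blast
  have entry: "(D ** map_matrix real_of_int B) $ i $ j = D $ i $ i * B $ i $ j" for i j
  proof -
    have "(D ** map_matrix real_of_int B) $ i $ j = (\<Sum>k\<in>UNIV. D $ i $ k * B $ k $ j)"
      by (simp add: matrix_matrix_mult_def map_matrix_def)
    also have "\<dots> = (\<Sum>k\<in>UNIV. if i = k then D $ i $ i * B $ i $ j else 0)"
      using diag by (intro sum.cong) auto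
    finally show ?thesis by simp
  qed
  have "D $ i $ i * B $ i $ j = - (D $ j $ j * B $ j $ i)" for i j
    using arg_cong[OF skew, of "\<lambda>M. M $ j $ i"] by (simp add: transpose_def entry)
  with pos show "\<exists>d. ?P d" by (intro exI[of _ "\<lambda>i. D $ i $ i"]) blast
next
  assume "\<exists>d. ?P d"
  then obtain d where pos: "\<And>i. 0 < d i"
    and skew: "\<And>i j. d i * real_of_int (B $ i $ j) = - (d j * real_of_int (B $ j $ i))" by blast
  define D :: "real^'n^'n" where "D = (\<chi> i j. if i = j then d i else 0)"
  have "(D ** map_matrix real_of_int B) $ i $ j = d i * B $ i $ j" for i j
  proof -
    have "(D ** map_matrix real_of_int B) $ i $ j
        = (\<Sum>k\<in>UNIV. (if i = k then d i else 0) * B $ k $ j)"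
      by (simp add: D_def matrix_matrix_mult_def map_matrix_def)
    also have "\<dots> = (\<Sum>k\<in>UNIV. if i = k then d i * B $ i $ j else 0)"
      by (intro sum.cong) auto
    finally show ?thesis by simp
  qed
  then have "transpose (D ** map_matrix real_of_int B) = - (D ** map_matrix real_of_int B)"
    unfolding vec_eq_iff transpose_def using skew by (metis uminus_vec_def vec_lambda_beta)
  then show "skew_symmetrizable B"
    unfolding skew_symmetrizable_def using pos by (intro exI[of _ D]) (auto simp: D_def)
qed

lemma skew_symmetrizable_diag:
  assumes "skew_symmetrizable B"
  shows "B $ k $ k = 0"
proof -
  obtain d :: "_ \<Rightarrow> real" where "0 < d k" "d k * B $ k $ k = - (d k * B $ k $ k)"
    using assms unfolding skew_symmetrizable_iff by metis
  then show ?thesis by simp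
qed

text \<open>The same diagonal scaling \<open>d\<close> serves the mutated matrix: passing to the
  transposed entry turns positive parts into negative parts, so the two product terms of the
  mutation rule are exchanged.\<close>

lemma skew_symmetrizable_mutation:
  assumes "skew_symmetrizable B"
  shows "skew_symmetrizable (matrix_mutation k B)"
proof -
  obtain d where pos: "\<And>i. 0 < d i"
    and skew: "\<And>i j. d i * real_of_int (B $ i $ j) = - (d j * real_of_int (B $ j $ i))"
    using assms unfolding skew_symmetrizable_iff by blast
  have scale: "d i * max x 0 = max (d i * x) 0" for i x
    using max_mult_distrib_left[of "d i" x 0] pos[of i] by simp
  have p: "d i * real_of_int (max (B $ i $ j) 0) = d j * real_of_int (max (- (B $ j $ i)) 0)" for i j
    using scale[of i "real_of_int (B $ i $ j)"] scale[of j "- real_of_int (B $ j $ i)"] skew[of i j]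
    by (simp add: of_int_max)
  \<comment> \<open>The weight travels from \<open>i\<close> to \<open>k\<close> and then to
    \<open>j\<close>, one use of \<open>p\<close> for each factor.\<close>
  have pp: "d i * (real_of_int (max (B $ i $ k) 0) * real_of_int (max (B $ k $ j) 0))
      = d j * (real_of_int (max (- (B $ j $ k)) 0) * real_of_int (max (- (B $ k $ i)) 0))" for i j
  proof -
    have "d i * (real_of_int (max (B $ i $ k) 0) * real_of_int (max (B $ k $ j) 0))
        = real_of_int (max (- (B $ k $ i)) 0) * (d k * real_of_int (max (B $ k $ j) 0))"
      using p[of i k] by simp
    then show ?thesis using p[of k j] by simp
  qed
  have "d i * real_of_int (matrix_mutation k B $ i $ j)
      = - (d j * real_of_int (matrix_mutation k B $ j $ i))" for i j
    using skew[of i j] pp[of i j] pp[of j i]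
    by (auto simp: matrix_mutation_def algebra_simps)
  with pos show ?thesis unfolding skew_symmetrizable_iff by blast
qed

section \<open>Radical vectors under mutation\<close>

definition radical :: "int^'n^'n \<Rightarrow> ('n \<Rightarrow> real) \<Rightarrow> bool" where
  "radical B a \<longleftrightarrow> (\<forall>i. (\<Sum>j\<in>UNIV. real_of_int (B $ i $ j) * a j) = 0)"

text \<open>This is the coordinate change for a mutation at a positive c-vector. A negative one
  would put \<open>- (B $ k $ j)\<close> inside the maximum, which gives the same value on radical
  vectors.\<close>

definition coord_mutation :: "'n \<Rightarrow> int^'n^'n \<Rightarrow> ('n \<Rightarrow> real) \<Rightarrow> 'n \<Rightarrow> real" where
  "coord_mutation k B a =
    a(k := - a k + (\<Sum>j\<in>UNIV. real_of_int (max (B $ k $ j) 0) * a j))"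

lemma radical_pos_part_eq_neg_part:
  assumes "radical B a"
  shows "(\<Sum>j\<in>UNIV. real_of_int (max (- (B $ k $ j)) 0) * a j)
    = (\<Sum>j\<in>UNIV. real_of_int (max (B $ k $ j) 0) * a j)"
proof -
  have "(\<Sum>j\<in>UNIV. real_of_int (max (B $ k $ j) 0) * a j)
      - (\<Sum>j\<in>UNIV. real_of_int (max (- (B $ k $ j)) 0) * a j)
      = (\<Sum>j\<in>UNIV. real_of_int (B $ k $ j) * a j)"
    unfolding sum_subtractf[symmetric] by (intro sum.cong) (auto simp: max_def)
  with assms show ?thesis by (simp add: radical_def)
qed

text \<open>Row \<open>k\<close> only changes sign, and its entry at \<open>k\<close> is zero. In
  any other row the product terms add ([B_ik]_+ - [-B_ik]_+) S = B_ik S, which the new k-th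
  coordinate takes away again.\<close>

lemma radical_coord_mutation:
  fixes B :: "int^'n^'n"
  assumes "skew_symmetrizable B" and rad: "radical B a"
  shows "radical (matrix_mutation k B) (coord_mutation k B a)"
  unfolding radical_def
proof
  fix i
  define S where "S = (\<Sum>j\<in>UNIV. real_of_int (max (B $ k $ j) 0) * a j)"
  have S': "(\<Sum>j\<in>UNIV. real_of_int (max (- (B $ k $ j)) 0) * a j) = S"
    using radical_pos_part_eq_neg_part[OF rad] by (simp add: S_def)
  have kk: "B $ k $ k = 0" using assms(1) by (rule skew_symmetrizable_diag)
  have row: "(\<Sum>j\<in>UNIV. real_of_int (B $ i $ j) * a j) = 0" for i
    using rad by (simp add: radical_def)
  have a': "coord_mutation k B a = a(k := - a k + S)" by (simp add: coord_mutation_def S_def)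
  let ?B = "matrix_mutation k B" and ?a = "coord_mutation k B a"
  show "(\<Sum>j\<in>UNIV. real_of_int (?B $ i $ j) * ?a j) = 0"
  proof (cases "i = k")
    case True
    then have "(\<Sum>j\<in>UNIV. real_of_int (?B $ i $ j) * ?a j)
        = (\<Sum>j\<in>UNIV. - (real_of_int (B $ k $ j) * a j))"
      using kk by (intro sum.cong) (auto simp: matrix_mutation_def a')
    then show ?thesis by (simp add: sum_negf row)
  next
    case False
    \<comment> \<open>At \<open>j = k\<close> the left summand is -B_ik (-a_k + S) = B_ik a_k - B_ik
      S, and on the right both product terms vanish because B_kk = 0.\<close>
    have "(\<Sum>j\<in>UNIV. real_of_int (?B $ i $ j) * ?a j)
        = (\<Sum>j\<in>UNIV. real_of_int (B $ i $ j) * a j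
            + real_of_int (max (B $ i $ k) 0) * (real_of_int (max (B $ k $ j) 0) * a j)
            - real_of_int (max (- (B $ i $ k)) 0) * (real_of_int (max (- (B $ k $ j)) 0) * a j)
            - (if j = k then real_of_int (B $ i $ k) * S else 0))"
      using False kk
      by (intro sum.cong)
        (auto simp: matrix_mutation_def a' algebra_simps)
    also have "\<dots> = real_of_int (max (B $ i $ k) 0) * S
        - real_of_int (max (- (B $ i $ k)) 0) * S - real_of_int (B $ i $ k) * S"
      by (simp only: sum.distrib sum_subtractf row sum_distrib_left[symmetric] S' S_def[symmetric]) simp
    also have "\<dots> = 0" by (simp add: max_def)
    finally show ?thesis .
  qed
qed

section \<open>Coordinates with respect to c-vectors\<close>

lemma is_coordinates_iff:
  "is_coordinates c v a \<longleftrightarrow> (\<forall>j. v $ j = (\<Sum>i\<in>UNIV. a i * real_of_int (c i $ j)))"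
  by (simp add: is_coordinates_def vec_eq_iff)

lemma is_coordinates_initial: "is_coordinates (\<lambda>i. axis i 1) v (($) v)"
  unfolding is_coordinates_iff
proof
  fix j
  have "(\<Sum>i\<in>UNIV. v $ i * real_of_int (axis i 1 $ j)) = (\<Sum>i\<in>UNIV. if i = j then v $ j else 0)"
    by (intro sum.cong) (auto simp: axis_def)
  then show "v $ j = (\<Sum>i\<in>UNIV. v $ i * real_of_int (axis i 1 $ j))" by simp
qed

text \<open>The changes of the c_i with i different from k add S c_k in total, for either sign of
  c_k. The k-th term becomes (-a_k + S)(-c_k) = a_k c_k - S c_k, which compensates.\<close>

lemma is_coordinates_mutation:
  fixes B :: "int^'n^'n"
  assumes "skew_symmetrizable B" and rad: "radical B a" and coord: "is_coordinates c v a"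
    and sgn: "0 < c k \<or> c k < 0"
  shows "is_coordinates (fst (y_seed_mutation k (c, B))) v (coord_mutation k B a)"
  unfolding is_coordinates_iff
proof
  fix j
  define s where "s = sgn_vec (c k)"
  have s: "s = 1 \<or> s = - 1" using sgn by (auto simp: s_def sgn_vec_def)
  define S where "S = (\<Sum>i\<in>UNIV. real_of_int (max (B $ k $ i) 0) * a i)"
  have S: "(\<Sum>i\<in>UNIV. real_of_int (max (s * B $ k $ i) 0) * a i) = S"
    using s radical_pos_part_eq_neg_part[OF rad] by (auto simp: S_def)
  have kk: "B $ k $ k = 0" using assms(1) by (rule skew_symmetrizable_diag)
  have a': "coord_mutation k B a = a(k := - a k + S)" by (simp add: coord_mutation_def S_def)
  have "(\<Sum>i\<in>UNIV. coord_mutation k B a i * real_of_int (fst (y_seed_mutation k (c, B)) i $ j))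
      = (\<Sum>i\<in>UNIV. a i * real_of_int (c i $ j)
          + (real_of_int (max (s * B $ k $ i) 0) * a i) * real_of_int (c k $ j)
          - (if i = k then S * real_of_int (c k $ j) else 0))"
    using kk by (intro sum.cong)
      (auto simp: a' s_def[symmetric] algebra_simps)
  also have "\<dots> = (\<Sum>i\<in>UNIV. a i * real_of_int (c i $ j))"
    by (simp only: sum.distrib sum_subtractf sum_distrib_right[symmetric] S) simp
  finally show "v $ j = (\<Sum>i\<in>UNIV. coord_mutation k B a i
      * real_of_int (fst (y_seed_mutation k (c, B)) i $ j))"
    using coord by (simp add: is_coordinates_iff)
qed

text \<open>Together with non-negativity of all coordinates of \<open>u0\<close>, this excludes zero
  c-vectors without a proof that the c-vectors form a basis.\<close>

lemma is_coordinates_zero_vector: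
  assumes "is_coordinates c v a" and "c k = 0"
  shows "is_coordinates c v (a(k := x))"
  unfolding is_coordinates_iff
proof
  fix j
  have "(\<Sum>i\<in>UNIV. (a(k := x)) i * real_of_int (c i $ j)) = (\<Sum>i\<in>UNIV. a i * real_of_int (c i $ j))"
    using assms(2) by (intro sum.cong) auto
  then show "v $ j = (\<Sum>i\<in>UNIV. (a(k := x)) i * real_of_int (c i $ j))"
    using assms(1) by (simp add: is_coordinates_iff)
qed

text \<open>The tuple \<open>c\<close> is hidden by the quantifier because the evolution of
  \<open>a\<close> and \<open>B\<close> under mutation does not depend on it. This lets seeds with
  different initial matrices be compared.\<close>

definition reachable_coordinates :: "int^'n^'n \<Rightarrow> real^'n \<Rightarrow> int^'n^'n \<Rightarrow> ('n \<Rightarrow> real) \<Rightarrow> bool" where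
  "reachable_coordinates B0 u0 B a \<longleftrightarrow> skew_symmetrizable B \<and> radical B a \<and>
    (\<exists>c. y_seed_wrt B0 (c, B) \<and> is_coordinates c u0 a)"

section \<open>Transport from \<open>B0\<close> and exclusion of maximal green sequences\<close>

context
  fixes B0 :: "int^'n^'n" and u0 :: "real^'n"
  assumes coherent: "sign_coherent B0"
    and nonneg: "\<forall>c B a. y_seed_wrt B0 (c, B) \<longrightarrow> is_coordinates c u0 a \<longrightarrow> (\<forall>i. 0 \<le> a i)"
begin

lemma reachable_coordinates_mutation:
  assumes "reachable_coordinates B0 u0 B a"
  shows "reachable_coordinates B0 u0 (matrix_mutation k B) (coord_mutation k B a)"
proof -
  obtain c where c: "skew_symmetrizable B" "radical B a" "y_seed_wrt B0 (c, B)" "is_coordinates c u0 a"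
    using assms by (auto simp: reachable_coordinates_def)
  txt \<open>If \<open>c k\<close> were zero, the \<open>k\<close>-th coordinate would be arbitrary and could be negative.\<close>
  have "c k \<noteq> 0"
  proof
    assume "c k = 0"
    then have "0 \<le> (a(k := - 1)) k"
      using nonneg c(3) is_coordinates_zero_vector[OF c(4)] by blast
    then show False by simp
  qed
  then have sgn: "0 < c k \<or> c k < 0"
    using coherent c(3) unfolding sign_coherent_def by (metis order_le_imp_less_or_eq)
  have "y_seed_wrt B0 (fst (y_seed_mutation k (c, B)), matrix_mutation k B)"
    using y_seed_wrt.mutate[OF c(3) sgn] by simp
  with c sgn show ?thesis
    unfolding reachable_coordinates_def
    using skew_symmetrizable_mutation radical_coord_mutation is_coordinates_mutation by blast
qed

lemma mutation_equivalent_reachable: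
  assumes "mutation_equivalent B0 B" and "reachable_coordinates B0 u0 B0 a"
  shows "\<exists>a. reachable_coordinates B0 u0 B a"
  using assms(1) unfolding mutation_equivalent_def
  by (induction rule: rtranclp_induct) (use assms(2) reachable_coordinates_mutation in blast)+

text \<open>Two seeds are mutated in parallel, one starting at \<open>B\<close> and one reached from
  \<open>B0\<close>. They begin with the same matrix and the same coordinates, of \<open>u\<close>
  and of \<open>u0\<close> respectively, and each mutation preserves this agreement.\<close>

lemma green_sequence_coordinates:
  assumes "reachable_coordinates B0 u0 B (($) u)" and "green_sequence B ks"
  shows "\<exists>a. is_coordinates (fst (fold y_seed_mutation ks (initial_y_seed B))) u a \<and>
    reachable_coordinates B0 u0 (snd (fold y_seed_mutation ks (initial_y_seed B))) a"
  using assms(2)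
proof (induction ks rule: rev_induct)
  case Nil
  then show ?case using assms(1) is_coordinates_initial by (auto simp: initial_y_seed_def)
next
  case (snoc k ks)
  obtain c B' where cB: "fold y_seed_mutation ks (initial_y_seed B) = (c, B')" by force
  have green: "0 < fst (fold y_seed_mutation (take m (ks @ [k])) (initial_y_seed B)) ((ks @ [k]) ! m)"
    if "m < Suc (length ks)" for m
    using snoc.prems that by (simp add: green_sequence_def)
  have "green_sequence B ks"
    unfolding green_sequence_def
  proof (intro allI impI)
    fix m assume "m < length ks"
    then show "0 < fst (fold y_seed_mutation (take m ks) (initial_y_seed B)) (ks ! m)"
      using green[of m] by (simp add: nth_append)
  qed
  then obtain a where a: "is_coordinates c u a" "reachable_coordinates B0 u0 B' a"
    using snoc.IH cB by auto
  have "0 < c k" using green[of "length ks"] cB by simp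
  with a have "is_coordinates (fst (y_seed_mutation k (c, B'))) u (coord_mutation k B' a)"
    by (intro is_coordinates_mutation) (auto simp: reachable_coordinates_def)
  with reachable_coordinates_mutation[OF a(2)] show ?case using cB by auto
qed

lemma no_maximal_green_sequence:
  assumes "0 < u0" and reach: "reachable_coordinates B0 u0 B a"
  shows "\<not> maximal_green_sequence B ks"
proof
  assume "maximal_green_sequence B ks"
  then have green: "green_sequence B ks"
    and neg: "\<And>k. fst (fold y_seed_mutation ks (initial_y_seed B)) k < 0"
    by (auto simp: maximal_green_sequence_def)
  define u :: "real^'n" where "u = vec_lambda a"
  have reach_nonneg: "0 \<le> a' i" if "reachable_coordinates B0 u0 B' a'" for a' B' i
    using that nonneg by (auto simp: reachable_coordinates_def)
  have u: "($) u = a" by (auto simp: u_def)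
  then obtain a' where a': "is_coordinates (fst (fold y_seed_mutation ks (initial_y_seed B))) u a'"
    "reachable_coordinates B0 u0 (snd (fold y_seed_mutation ks (initial_y_seed B))) a'"
    using green_sequence_coordinates[of B u ks] reach green by auto
  have "a j \<le> 0" for j
  proof -
    have "fst (fold y_seed_mutation ks (initial_y_seed B)) i $ j \<le> 0" for i
      using neg[of i] by (simp add: less_vec_def less_eq_vec_def)
    moreover have "0 \<le> a' i" for i using reach_nonneg[OF a'(2)] .
    moreover have "u $ j = (\<Sum>i\<in>UNIV. a' i *
        real_of_int (fst (fold y_seed_mutation ks (initial_y_seed B)) i $ j))"
      using a'(1) by (simp add: is_coordinates_iff)
    ultimately have "u $ j \<le> 0" by (auto intro!: sum_nonpos mult_nonneg_nonpos)
    then show ?thesis by (simp add: u_def)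
  qed
  \<comment> \<open>The numbers \<open>a\<close> are the entries of \<open>u\<close>, now
    non-positive, but also coordinates of \<open>u0\<close> in a seed over \<open>B0\<close>, hence
    non-negative. Their vanishing therefore makes \<open>u0\<close> itself zero.\<close>
  then have "a j = 0" for j using reach_nonneg[OF reach] by (simp add: order_antisym)
  then have "u0 = 0" using reach by (auto simp: reachable_coordinates_def is_coordinates_def)
  with \<open>0 < u0\<close> show False by simp
qed

end

theorem theorem2:
  fixes B0 :: "int^'n^'n" and u0 :: "real^'n"
  assumes "skew_symmetrizable B0"
    and "0 < u0"
    and "map_matrix real_of_int B0 *v u0 = 0"
    and "\<forall>B1. mutation_equivalent B0 B1 \<longrightarrow> sign_coherent B1"
    and "\<forall>c B a. y_seed_wrt B0 (c, B) \<longrightarrow> is_coordinates c u0 a \<longrightarrow> (\<forall>i. 0 \<le> a i)"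
  shows "\<forall>B. mutation_equivalent B0 B \<longrightarrow> \<not> (\<exists>ks. maximal_green_sequence B ks)"
proof (intro allI impI)
  fix B assume B: "mutation_equivalent B0 B"
  have coherent: "sign_coherent B0"
    using assms(4) by (simp add: mutation_equivalent_def)
  have "radical B0 (($) u0)"
    using assms(3) by (simp add: radical_def vec_eq_iff matrix_vector_mult_def map_matrix_def)
  moreover have "y_seed_wrt B0 (\<lambda>i. axis i 1, B0)"
    using y_seed_wrt.initial[of B0] by (simp add: initial_y_seed_def)
  ultimately have "reachable_coordinates B0 u0 B0 (($) u0)"
    using assms(1) is_coordinates_initial by (auto simp: reachable_coordinates_def)
  then obtain a where "reachable_coordinates B0 u0 B a"
    using mutation_equivalent_reachable[OF coherent assms(5) B] by blast
  then show "\<not> (\<exists>ks. maximal_green_sequence B ks)"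
    using no_maximal_green_sequence[OF coherent assms(5,2)] by blast
qed

end
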